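(* Let $T>R>P>S$ be real numbers with $2R>T+S$. Let $\ell$ be a separation line with associated affine function $L$ such that $L(R,R)=0$ and $L(P,R)>0$; that is, $\ell$ is a line through $(R,R)$ with slope $m$ satisfying $0<m\le 1$. Let $\pi:\mathcal{S}\to[0,1]$ be a Smale plan. If $\pi(s)=0$ for every $s\in\mathcal{S}$ with $L(s)>0$, then $\pi$ satisfies the Protection Condition. In particular, if $\pi$ is a simple Smale plan with separation line $\ell$, then $\pi$ satisfies the Protection Condition.
   Context: Iterated Prisoner's Dilemma. In each round $n=1,2,\dots$ players X and Y simultaneously choose $c$ or $d$. Outcomes are written with X's choice first; outcomes $cc,cd,dc,dd$ give the payoff pairs $S^n=(S^n_X,S^n_Y)=(R,R),(S,T),(T,S),(P,P)$ respectively. Let $\mathcal{S}\subset\mathbb{R}^2$ be the convex hull of these four points and $s^N=\frac1N\sum_{n=1}^N S^n\in\mathcal{S}$. A Smale plan is a function $\pi:\mathcal{S}\to[0,1]$. If X uses $\pi$, then in round $N+1$ X plays $c$ with probability $\pi(s^N)$ (surely $c$ if this is $1$, surely $d$ if it is $0$). X eventually plays $\pi$ if there is $N^*$ such that X uses $\pi$ in round $N+1$ for all $N\ge N^*$; X's earlier play is arbitrary. A separation line is a line $\ell\subset\mathbb{R}^2$ such that $(S,T)$ and $(R,R)$ lie in one of the two closed half-planes bounded by $\ell$ while $(P,P)$ and $(T,S)$ lie in the other. Such a line is never vertical. An affine function $L:\mathbb{R}^2\to\mathbb{R}$ associated with $\ell$ is one which is zero on $\ell$ and positive strictly above $\ell$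 (hence negative strictly below). A simple Smale plan with separation line $\ell$ is a map $\pi:\mathcal{S}\to[0,1]$ with $\pi(s)=0$ if $L(s)>0$ and $\pi(s)=1$ if $L(s)<0$ (values on $\ell$ are unspecified). Protection Condition for $\pi$: if X eventually plays $\pi$, with arbitrary initial play and with Y playing in any way whatsoever, and $s^*=(s^*_X,s^*_Y)$ is a limit point of the sequence $\{s^N\}$, then $s^*_Y\ge R$ implies $s^*_X=s^*_Y=R$. *)

theory Defs
  imports "HOL-Probability.Probability"
begin

datatype move = Coop | Defect

text \<open>A play lists the outcomes (X's move first). Numbering starts at 0:
  entry \<open>n\<close> is the outcome of round \<open>n + 1\<close>.\<close>

type_synonym play = "nat \<Rightarrow> move \<times> move"

fun payoff :: "real \<Rightarrow> real \<Rightarrow> real \<Rightarrow> real \<Rightarrow> move \<times> move \<Rightarrow> real \<times> real" where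
  "payoff T R P S (Coop, Coop) = (R, R)"
| "payoff T R P S (Coop, Defect) = (S, T)"
| "payoff T R P S (Defect, Coop) = (T, S)"
| "payoff T R P S (Defect, Defect) = (P, P)"

definition payoff_set :: "real \<Rightarrow> real \<Rightarrow> real \<Rightarrow> real \<Rightarrow> (real \<times> real) set" where
  "payoff_set T R P S = convex hull {(R, R), (S, T), (T, S), (P, P)}"

definition avg_payoff :: "real \<Rightarrow> real \<Rightarrow> real \<Rightarrow> real \<Rightarrow> play \<Rightarrow> nat \<Rightarrow> real \<times> real" where
  "avg_payoff T R P S \<omega> N = (1 / real N) *\<^sub>R (\<Sum>n<N. payoff T R P S (\<omega> n))"

definition smale_plan ::
  "real \<Rightarrow> real \<Rightarrow> real \<Rightarrow> real \<Rightarrow> (real \<times> real \<Rightarrow> real) \<Rightarrow> bool" where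
  "smale_plan T R P S \<pi> \<longleftrightarrow> (\<forall>s\<in>payoff_set T R P S. 0 \<le> \<pi> s \<and> \<pi> s \<le> 1)"

text \<open>A random play is a probability measure on a set of plays, \<open>space M\<close> being the set of
  plays that can occur. Sample points being plays is no restriction: in any model of the game
  each sample point may be replaced by the play it produces. Nothing else is assumed about the
  joint behaviour of the two players, so Y may play in any way whatsoever.\<close>

definition random_play :: "play measure \<Rightarrow> bool" where
  "random_play M \<longleftrightarrow>
     prob_space M \<and> (\<forall>n. (\<lambda>\<omega>. \<omega> n) \<in> measurable M (count_space UNIV))"

text \<open>X uses \<open>\<pi>\<close> in round \<open>N + 1\<close>: conditionally on each history of \<open>N\<close> rounds, X
  cooperates with probability \<open>\<pi> s\<^sup>N\<close>. The values 0 and 1 are binding on every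
  possible play, not just almost surely.\<close>

definition uses_plan_after ::
  "real \<Rightarrow> real \<Rightarrow> real \<Rightarrow> real \<Rightarrow> (real \<times> real \<Rightarrow> real) \<Rightarrow> play measure \<Rightarrow> nat \<Rightarrow> bool" where
  "uses_plan_after T R P S \<pi> M N \<longleftrightarrow>
     (\<forall>h\<in>space M. \<P>(\<omega> in M. \<forall>n<N. \<omega> n = h n) > 0 \<longrightarrow>
        \<P>(\<omega> in M. fst (\<omega> N) = Coop \<bar> \<forall>n<N. \<omega> n = h n) = \<pi> (avg_payoff T R P S h N)) \<and>
     (\<forall>\<omega>\<in>space M.
        (\<pi> (avg_payoff T R P S \<omega> N) = 1 \<longrightarrow> fst (\<omega> N) = Coop) \<and>
        (\<pi> (avg_payoff T R P S \<omega> N) = 0 \<longrightarrow> fst (\<omega> N) = Defect))"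

text \<open>There is no average payoff before the first round, whence \<open>N0 \<ge> 1\<close>.\<close>

definition eventually_plays ::
  "real \<Rightarrow> real \<Rightarrow> real \<Rightarrow> real \<Rightarrow> (real \<times> real \<Rightarrow> real) \<Rightarrow> play measure \<Rightarrow> bool" where
  "eventually_plays T R P S \<pi> M \<longleftrightarrow> (\<exists>N0\<ge>1. \<forall>N\<ge>N0. uses_plan_after T R P S \<pi> M N)"

definition limit_point :: "(nat \<Rightarrow> 'a::topological_space) \<Rightarrow> 'a \<Rightarrow> bool" where
  "limit_point f x \<longleftrightarrow> (\<exists>r::nat \<Rightarrow> nat. strict_mono r \<and> (f \<circ> r) \<longlonglongrightarrow> x)"

definition protection_condition ::
  "real \<Rightarrow> real \<Rightarrow> real \<Rightarrow> real \<Rightarrow> (real \<times> real \<Rightarrow> real) \<Rightarrow> bool" where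
  "protection_condition T R P S \<pi> \<longleftrightarrow>
     (\<forall>M. random_play M \<and> eventually_plays T R P S \<pi> M \<longrightarrow>
       (\<forall>\<omega>\<in>space M. \<forall>s. limit_point (avg_payoff T R P S \<omega>) s \<longrightarrow>
          snd s \<ge> R \<longrightarrow> fst s = R \<and> snd s = R))"

text \<open>Replacing \<open>(v, c)\<close> by its negative exchanges the two half-planes, so fixing the
  direction of the inequalities loses no generality.\<close>

definition separation_line ::
  "real \<Rightarrow> real \<Rightarrow> real \<Rightarrow> real \<Rightarrow> (real \<times> real) set \<Rightarrow> bool" where
  "separation_line T R P S l \<longleftrightarrow>
     (\<exists>v c. v \<noteq> 0 \<and> l = {x. v \<bullet> x = c} \<and>
        {(S, T), (R, R)} \<subseteq> {x. v \<bullet> x \<le> c} \<and> {(P, P), (T, S)} \<subseteq> {x. v \<bullet> x \<ge> c})"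

definition associated_affine :: "(real \<times> real) set \<Rightarrow> (real \<times> real \<Rightarrow> real) \<Rightarrow> bool" where
  "associated_affine l L \<longleftrightarrow>
     (\<exists>f c. linear f \<and> L = (\<lambda>s. f s + c)) \<and>
     (\<forall>s\<in>l. L s = 0) \<and>
     (\<forall>x y y'. (x, y) \<in> l \<and> y < y' \<longrightarrow> L (x, y') > 0)"

text \<open>For \<open>T > R > P > S\<close> a separation line is never vertical, so \<open>L\<close> is unique up to
  a positive factor and its choice is immaterial.\<close>

definition simple_smale_plan ::
  "real \<Rightarrow> real \<Rightarrow> real \<Rightarrow> real \<Rightarrow> (real \<times> real) set \<Rightarrow> (real \<times> real \<Rightarrow> real) \<Rightarrow> bool" where
  "simple_smale_plan T R P S l \<pi> \<longleftrightarrow>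
     separation_line T R P S l \<and> smale_plan T R P S \<pi> \<and>
     (\<exists>L. associated_affine l L \<and>
        (\<forall>s\<in>payoff_set T R P S. (L s > 0 \<longrightarrow> \<pi> s = 0) \<and> (L s < 0 \<longrightarrow> \<pi> s = 1)))"

end

theory Submission imports Defs begin

text \<open>Write \<open>l\<close> as the line of slope \<open>m\<close> through \<open>(R, R)\<close>, and let \<open>h(s) = s\<^sub>Y - R - m (s\<^sub>X - R)\<close>
  be the signed height of \<open>s\<close> above it. Since \<open>h\<close> is affine, \<open>N h(s\<^sup>N)\<close> is the sum of the heights
  of the first \<open>N\<close> outcomes. Once X plays the plan, X defects whenever \<open>s\<^sup>N\<close> lies strictly above
  \<open>l\<close>, so the next outcome is \<open>(T, S)\<close> or \<open>(P, P)\<close>; neither lies above \<open>l\<close>, so the sum does not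
  grow. While \<open>s\<^sup>N\<close> lies on or below \<open>l\<close>, one round adds at most a constant to a nonpositive sum.
  Hence the sum is bounded above (\<open>partial_sums_bounded_above_if_nonpos_steps\<close>), and after
  division by \<open>N\<close> no limit point lies strictly above \<open>l\<close>
  (\<open>limit_point_avg_payoff_not_above\<close>).

  A limit point with \<open>s\<^sub>Y \<ge> R\<close> on or below a line of positive slope through \<open>(R, R)\<close> also has
  \<open>s\<^sub>X \<ge> R\<close>. As \<open>2 R > T + S\<close> and \<open>R > P\<close> force \<open>s\<^sub>X + s\<^sub>Y \<le> 2 R\<close>, both coordinates equal \<open>R\<close>.

  The argument runs on each possible play separately, since the value \<open>0\<close> of the plan binds X on
  every play.\<close>

lemma avg_payoff_in_payoff_set:
  assumes "N \<ge> 1"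
  shows "avg_payoff T R P S \<omega> N \<in> payoff_set T R P S"
proof -
  have mem: "payoff T R P S p \<in> payoff_set T R P S" for p
    unfolding payoff_set_def
    by (rule hull_inc, cases "(T, R, P, S, p)" rule: payoff.cases) auto
  have "(\<Sum>n<N. (1 / real N) *\<^sub>R payoff T R P S (\<omega> n)) \<in> payoff_set T R P S"
  proof (rule convex_sum)
    show "convex (payoff_set T R P S)"
      by (simp add: payoff_set_def convex_convex_hull)
  qed (use assms mem in auto)
  then show ?thesis
    by (simp add: avg_payoff_def scaleR_sum_right)
qed

lemma avg_payoff_coordinates:
  shows "fst (avg_payoff T R P S \<omega> N) = (\<Sum>n<N. fst (payoff T R P S (\<omega> n))) / real N"
    and "snd (avg_payoff T R P S \<omega> N) = (\<Sum>n<N. snd (payoff T R P S (\<omega> n))) / real N"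
  by (simp_all add: avg_payoff_def fst_sum snd_sum)

lemma sum_height_eq_avg_payoff:
  assumes "N \<ge> 1"
  shows "(\<Sum>n<N. snd (payoff T R P S (\<omega> n)) - R - m * (fst (payoff T R P S (\<omega> n)) - R))
    = real N * (snd (avg_payoff T R P S \<omega> N) - R - m * (fst (avg_payoff T R P S \<omega> N) - R))"
proof -
  have "real N > 0" using assms by simp
  then show ?thesis
    unfolding avg_payoff_coordinates sum_subtractf sum_distrib_left[symmetric] sum_constant
    by (simp add: right_diff_distrib mult.left_commute[of "real N"])
qed

text \<open>A sum above zero does not grow, and a sum at or below zero can overshoot zero by at most one
  increment.\<close>

lemma partial_sums_bounded_above_if_nonpos_steps:
  fixes a :: "nat \<Rightarrow> real"
  assumes nonpos: "\<And>n. n \<ge> N0 \<Longrightarrow> (\<Sum>i<n. a i) > 0 \<Longrightarrow> a n \<le> 0"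
    and bound: "\<And>n. a n \<le> C"
    and "N \<ge> N0"
  shows "(\<Sum>i<N. a i) \<le> max (\<Sum>i<N0. a i) C"
  using \<open>N \<ge> N0\<close>
proof (induction N rule: dec_induct)
  case base
  show ?case by simp
next
  case (step n)
  then show ?case
    using nonpos[of n] bound[of n] by (cases "(\<Sum>i<n. a i) > 0") auto
qed

lemma associated_affine_reflect:
  assumes L: "associated_affine l L" and p: "(x, p) \<in> l"
  shows "L (x, 2 * p - y) = - L (x, y)"
proof -
  obtain f c where f: "linear f" and Lf: "L = (\<lambda>s. f s + c)"
    using L unfolding associated_affine_def by blast
  have "L (x, p) = 0"
    using L p unfolding associated_affine_def by blast
  moreover have "f (x, y) + f (x, 2 * p - y) = f (2 *\<^sub>R (x, p))"
    by (simp add: linear_add[OF f, symmetric])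
  moreover have "f (2 *\<^sub>R (x, p)) = 2 * f (x, p)"
    by (simp only: linear_scale[OF f] real_scaleR_def)
  ultimately show ?thesis
    by (simp add: Lf)
qed

text \<open>Positivity strictly above the line is part of being associated. A point strictly below it is the
  vertical reflection in the line of a point strictly above it, and the reflection changes the
  sign of \<open>L\<close>.\<close>

lemma associated_affine_sign:
  assumes L: "associated_affine l L" and p: "(x, p) \<in> l"
  shows "L (x, y) > 0 \<longleftrightarrow> y > p" and "L (x, y) = 0 \<longleftrightarrow> y = p"
proof -
  have zero: "L (x, p) = 0"
    using L p unfolding associated_affine_def by blast
  have pos: "L (x, y') > 0" if "p < y'" for y'
    using L p that unfolding associated_affine_def by blast
  have "L (x, y) < 0" if "y < p"
    using pos[of "2 * p - y"] associated_affine_reflect[OF L p, of y] that by simp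
  then show "L (x, y) > 0 \<longleftrightarrow> y > p" and "L (x, y) = 0 \<longleftrightarrow> y = p"
    using zero pos[of y] by (cases y p rule: linorder_cases; force)+
qed

text \<open>The position of \<open>(P, P)\<close> against \<open>(R, R)\<close> and of \<open>(T, S)\<close> against \<open>(S, T)\<close> bounds the slope
  in absolute value by \<open>1\<close>. As \<open>L\<close> has the sign of the height above the line, \<open>L (R, R) = 0\<close> puts
  \<open>(R, R)\<close> on the line and \<open>L (P, R) > 0\<close> puts \<open>(P, R)\<close>, to the left of it, strictly above, which
  makes the slope positive.\<close>

lemma separation_line_through_reward_iff:
  fixes T R P S :: real
  assumes "T > R" "R > P" "P > S"
    and L: "associated_affine l L"
  shows "(separation_line T R P S l \<and> L (R, R) = 0 \<and> L (P, R) > 0) \<longleftrightarrow>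
    (\<exists>m. 0 < m \<and> m \<le> 1 \<and> l = {(x, y). y - R = m * (x - R)})"
proof
  assume "separation_line T R P S l \<and> L (R, R) = 0 \<and> L (P, R) > 0"
  then have LRR: "L (R, R) = 0" and LPR: "L (P, R) > 0"
    and "separation_line T R P S l" by auto
  then obtain a b c where v: "(a, b) \<noteq> (0::real \<times> real)" and l: "l = {z. (a, b) \<bullet> z = c}"
    and sep: "a * S + b * T \<le> c" "a * R + b * R \<le> c" "a * P + b * P \<ge> c" "a * T + b * S \<ge> c"
    by (auto simp: separation_line_def)
  have "(a + b) * (R - P) \<le> 0" "(b - a) * (T - S) \<le> 0"
    using sep by (simp_all add: algebra_simps)
  then have ab: "a + b \<le> 0" "b - a \<le> 0"
    using assms by (auto simp: mult_le_0_iff)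
  with v have b: "b < 0" by (auto simp: zero_prod_def)
  define m where "m = - a / b"
  define q where "q = c / b + m * R"
  have l': "l = {(x, y). y - q = m * (x - R)}"
  proof -
    have "a * x + b * y = c \<longleftrightarrow> y - q = m * (x - R)" for x y
    proof -
      have "a * x + b * y - c = b * (y - q - m * (x - R))"
        using b by (simp add: m_def q_def field_simps)
      then have "a * x + b * y = c \<longleftrightarrow> b * (y - q - m * (x - R)) = 0" by linarith
      with b show ?thesis by simp
    qed
    then show ?thesis
      unfolding l by (simp add: set_eq_iff)
  qed
  have "q = R"
    using associated_affine_sign(2)[OF L, of R q R] LRR by (simp add: l')
  then have l'': "l = {(x, y). y - R = m * (x - R)}"
    using l' by simp
  have "m * (R - P) > 0"
    using associated_affine_sign(1)[OF L, of P "R + m * (P - R)" R] LPR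
    by (simp add: l'' algebra_simps)
  then have "m > 0"
    using assms by (simp add: zero_less_mult_iff)
  moreover have "m \<le> 1"
    using ab b by (simp add: m_def field_simps)
  ultimately show "\<exists>m. 0 < m \<and> m \<le> 1 \<and> l = {(x, y). y - R = m * (x - R)}"
    using l'' by blast
next
  assume "\<exists>m. 0 < m \<and> m \<le> 1 \<and> l = {(x, y). y - R = m * (x - R)}"
  then obtain m where m: "0 < m" "m \<le> 1" and l: "l = {(x, y). y - R = m * (x - R)}"
    by blast
  have "m * (S - R) \<le> 0" "m * (T - R) \<ge> 0" "(1 - m) * (R - P) \<ge> 0" "m * (R - P) > 0"
    using m assms by (auto simp: mult_le_0_iff)
  note signs = this
  have "separation_line T R P S l"
    unfolding separation_line_def
  proof (intro exI conjI)
    show "(m, -1) \<noteq> (0::real \<times> real)" by (simp add: zero_prod_def)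
    show "l = {z. (m, -1) \<bullet> z = (m - 1) * R}"
      by (auto simp: l algebra_simps)
  qed (use signs assms in \<open>auto simp: algebra_simps\<close>)
  moreover have "L (R, R) = 0"
    using L by (auto simp: associated_affine_def l)
  moreover have "L (P, R) > 0"
    using associated_affine_sign(1)[OF L, of P "R + m * (P - R)" R] signs
    by (simp add: l algebra_simps)
  ultimately show "separation_line T R P S l \<and> L (R, R) = 0 \<and> L (P, R) > 0"
    by blast
qed

text \<open>The four outcomes pay the two players together \<open>2 R\<close>, \<open>S + T\<close> or \<open>2 P\<close>, never more than \<open>2 R\<close>;
  the bound passes to averages and to their limits.\<close>

lemma limit_point_avg_payoff_sum_le:
  fixes T R P S :: real
  assumes "R > P" "2 * R > T + S"
    and lim: "limit_point (avg_payoff T R P S \<omega>) s"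
  shows "fst s + snd s \<le> 2 * R"
proof -
  obtain r :: "nat \<Rightarrow> nat" where r: "strict_mono r" "(avg_payoff T R P S \<omega> \<circ> r) \<longlonglongrightarrow> s"
    using lim by (auto simp: limit_point_def)
  have le: "fst (payoff T R P S p) + snd (payoff T R P S p) \<le> 2 * R" for p
    using assms by (cases "(T, R, P, S, p)" rule: payoff.cases) auto
  have avg: "fst (avg_payoff T R P S \<omega> N) + snd (avg_payoff T R P S \<omega> N) \<le> 2 * R"
    if "N \<ge> 1" for N
    using sum_mono[of "{..<N}", OF le] that
    by (simp add: avg_payoff_coordinates sum.distrib field_simps)
  have "(\<lambda>k. fst (avg_payoff T R P S \<omega> (r k)) + snd (avg_payoff T R P S \<omega> (r k)))
      \<longlonglongrightarrow> fst s + snd s"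
    using r(2) by (auto intro!: tendsto_intros simp: o_def)
  moreover have "\<exists>K. \<forall>k\<ge>K.
      fst (avg_payoff T R P S \<omega> (r k)) + snd (avg_payoff T R P S \<omega> (r k)) \<le> 2 * R"
    using avg seq_suble[OF r(1)] by (meson order_trans)
  ultimately show ?thesis by (rule LIMSEQ_le_const2)
qed

lemma limit_point_avg_payoff_not_above:
  fixes T R P S m :: real
  assumes "T > R" "R > P" "P > S" "0 < m" "m \<le> 1"
    and lim: "limit_point (avg_payoff T R P S \<omega>) s"
    and "N0 \<ge> 1"
    and defect: "\<And>N. N \<ge> N0 \<Longrightarrow>
      snd (avg_payoff T R P S \<omega> N) - R > m * (fst (avg_payoff T R P S \<omega> N) - R) \<Longrightarrow>
      fst (\<omega> N) = Defect"
  shows "snd s - R \<le> m * (fst s - R)"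
proof -
  define height where "height z = snd z - R - m * (fst z - R)" for z :: "real \<times> real"
  define a where "a n = height (payoff T R P S (\<omega> n))" for n
  define A where "A N = avg_payoff T R P S \<omega> N" for N
  have heights: "height (T, S) \<le> 0" "height (P, P) \<le> 0" "height (S, T) \<ge> 0" "height (R, R) = 0"
  proof -
    have "m * (T - R) \<ge> 0" "(1 - m) * (P - R) \<le> 0" "m * (S - R) \<le> 0"
      using assms by (auto simp: mult_le_0_iff)
    moreover have "height (P, P) = (1 - m) * (P - R)"
      by (simp add: height_def algebra_simps)
    ultimately show "height (T, S) \<le> 0" "height (P, P) \<le> 0" "height (S, T) \<ge> 0" "height (R, R) = 0"
      using assms(1-3) unfolding height_def fst_conv snd_conv by (linarith, linarith, linarith, simp)
  qed
  have sum_a: "(\<Sum>i<N. a i) = real N * height (A N)" if "N \<ge> 1" for N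
    using sum_height_eq_avg_payoff[OF that] by (simp add: a_def height_def A_def)
  have nonpos: "a N \<le> 0" if N: "N \<ge> N0" "(\<Sum>i<N. a i) > 0" for N
  proof -
    have "height (A N) > 0"
      using N \<open>N0 \<ge> 1\<close> by (simp add: sum_a zero_less_mult_iff)
    then have "fst (\<omega> N) = Defect"
      using defect N(1) by (simp add: height_def A_def)
    then have "payoff T R P S (\<omega> N) \<in> {(T, S), (P, P)}"
      by (cases "(T, R, P, S, \<omega> N)" rule: payoff.cases) auto
    then show ?thesis
      using heights by (auto simp: a_def)
  qed
  \<comment> \<open>Only \<open>(S, T)\<close> lies strictly above the line, so its height bounds every increment.\<close>
  define C where "C = height (S, T)"
  have bound: "a n \<le> C" for n
    using heights by (cases "(T, R, P, S, \<omega> n)" rule: payoff.cases) (auto simp: a_def C_def)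
  define B where "B = max (\<Sum>i<N0. a i) C"
  have height_le: "height (A N) \<le> B / real N" if "N \<ge> N0" for N
    using partial_sums_bounded_above_if_nonpos_steps[of N0 a C N, OF nonpos bound that]
      sum_a[of N] that \<open>N0 \<ge> 1\<close>
    by (simp add: B_def field_simps)
  obtain r :: "nat \<Rightarrow> nat" where r: "strict_mono r" "(A \<circ> r) \<longlonglongrightarrow> s"
    using lim by (auto simp: limit_point_def A_def[abs_def])
  have "(\<lambda>k. height (A (r k))) \<longlonglongrightarrow> height s"
    unfolding height_def using r(2) by (auto intro!: tendsto_intros simp: o_def)
  moreover have "(\<lambda>k. B / real (r k)) \<longlonglongrightarrow> 0"
    using LIMSEQ_subseq_LIMSEQ[OF lim_const_over_n[of B] r(1)] by (simp add: o_def)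
  moreover have "\<exists>K. \<forall>k\<ge>K. height (A (r k)) \<le> B / real (r k)"
    using height_le seq_suble[OF r(1)] by (meson order_trans)
  ultimately have "height s \<le> 0" by (rule LIMSEQ_le)
  then show ?thesis by (simp add: height_def)
qed

lemma protection_condition_if_defects_above_line:
  fixes T R P S m :: real
  assumes "T > R" "R > P" "P > S" "2 * R > T + S" "0 < m" "m \<le> 1"
    and defect: "\<forall>s\<in>payoff_set T R P S. snd s - R > m * (fst s - R) \<longrightarrow> \<pi> s = 0"
  shows "protection_condition T R P S \<pi>"
  unfolding protection_condition_def
proof (intro allI impI ballI)
  fix M \<omega> s
  assume M: "random_play M \<and> eventually_plays T R P S \<pi> M" and \<omega>: "\<omega> \<in> space M"
    and lim: "limit_point (avg_payoff T R P S \<omega>) s" and s: "snd s \<ge> R"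
  from M obtain N0 where "N0 \<ge> 1" and uses: "\<And>N. N \<ge> N0 \<Longrightarrow> uses_plan_after T R P S \<pi> M N"
    by (auto simp: eventually_plays_def)
  have "snd s - R \<le> m * (fst s - R)"
  proof (rule limit_point_avg_payoff_not_above[OF assms(1-3,5,6) lim \<open>N0 \<ge> 1\<close>])
    fix N
    assume N: "N \<ge> N0"
      and "snd (avg_payoff T R P S \<omega> N) - R > m * (fst (avg_payoff T R P S \<omega> N) - R)"
    then have "\<pi> (avg_payoff T R P S \<omega> N) = 0"
      using defect avg_payoff_in_payoff_set[of N] \<open>N0 \<ge> 1\<close> by auto
    then show "fst (\<omega> N) = Defect"
      using uses[OF N] \<omega> by (auto simp: uses_plan_after_def)
  qed
  then have "m * (fst s - R) \<ge> 0"
    using s by simp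
  then have "fst s \<ge> R"
    using \<open>0 < m\<close> by (simp add: zero_le_mult_iff)
  then show "fst s = R \<and> snd s = R"
    using s limit_point_avg_payoff_sum_le[OF assms(2,4) lim] by simp
qed

theorem theorem3p2:
  fixes T R P S :: real
    and l :: "(real \<times> real) set" and L \<pi> :: "real \<times> real \<Rightarrow> real"
  assumes "T > R" and "R > P" and "P > S" and "2 * R > T + S"
    and "associated_affine l L"
    and "smale_plan T R P S \<pi>"
  shows "((separation_line T R P S l \<and> L (R, R) = 0 \<and> L (P, R) > 0) \<longleftrightarrow>
            (\<exists>m. 0 < m \<and> m \<le> 1 \<and> l = {(x, y). y - R = m * (x - R)})) \<and>
         (separation_line T R P S l \<and> L (R, R) = 0 \<and> L (P, R) > 0 \<longrightarrow>
            ((\<forall>s\<in>payoff_set T R P S. L s > 0 \<longrightarrow> \<pi> s = 0) \<longrightarrow> protection_condition T R P S \<pi>) \<and>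
            (simple_smale_plan T R P S l \<pi> \<longrightarrow> protection_condition T R P S \<pi>))"
    (is "?iff \<and> (?line \<longrightarrow> (?zero L \<longrightarrow> ?protects) \<and> (?simple \<longrightarrow> ?protects))")
proof (intro conjI impI)
  show iff: ?iff
    by (rule separation_line_through_reward_iff[OF assms(1-3,5)])
  \<comment> \<open>A simple plan comes with an associated function of its own, so the conclusion is needed for
     every associated function of the line.\<close>
  have protects: ?protects if ?line "associated_affine l L'" "?zero L'" for L'
  proof -
    obtain m where m: "0 < m" "m \<le> 1" and l: "l = {(x, y). y - R = m * (x - R)}"
      using iff \<open>?line\<close> by blast
    have "\<pi> s = 0" if "s \<in> payoff_set T R P S" "snd s - R > m * (fst s - R)" for s
      using associated_affine_sign(1)[OF \<open>associated_affine l L'\<close>,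
          of "fst s" "R + m * (fst s - R)" "snd s"] \<open>?zero L'\<close> that
      by (auto simp: l)
    then show ?thesis
      using protection_condition_if_defects_above_line[OF assms(1-4) m] by blast
  qed
  show ?protects if ?line "?zero L"
    using protects[OF that(1) assms(5) that(2)] .
  show ?protects if ?line ?simple
    using protects[OF that(1)] that(2) by (auto simp: simple_smale_plan_def)
qed

end
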